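(* Let $k$ be a positive integer, let $\lambda_1,\lambda_2,\dots,\lambda_k$ be any nonzero complex scalars, and let $\varphi_1,\varphi_2,\dots,\varphi_k$ be any analytic self-maps of $\mathbb{D}$. Then the operator $\sum_{i=1}^k\lambda_i C_{\varphi_i}$ is compact on $H^\infty$ if and only if $$\lim_{n\to\infty}\|\lambda_1\varphi_1^n+\lambda_2\varphi_2^n+\cdots+\lambda_k\varphi_k^n\|_{\infty}=0.$$
   Context: $\mathbb{D}$ is the open unit disk in $\mathbb{C}$. $H^\infty=H^\infty(\mathbb{D})$ is the Banach algebra of all bounded analytic functions on $\mathbb{D}$ with the supremum norm $\|f\|_\infty=\sup_{z\in\mathbb{D}}|f(z)|$. An analytic self-map of $\mathbb{D}$ is an analytic function $\varphi:\mathbb{D}\to\mathbb{D}$; it induces the composition operator $C_\varphi f=f\circ\varphi$ on functions analytic in $\mathbb{D}$. Here $\varphi^n$ denotes the $n$-th pointwise power, $\varphi^n(z)=(\varphi(z))^n$. *)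

theory Defs
  imports "HOL-Complex_Analysis.Complex_Analysis"
begin

abbreviation unit_disk :: "complex set" where
  "unit_disk \<equiv> ball 0 1"

definition analytic_self_map :: "(complex \<Rightarrow> complex) \<Rightarrow> bool" where
  "analytic_self_map \<phi> \<longleftrightarrow> \<phi> holomorphic_on unit_disk \<and> \<phi> ` unit_disk \<subseteq> unit_disk"

(* Meaningful only for functions that are bounded on the disk. *)
definition disk_sup_norm :: "(complex \<Rightarrow> complex) \<Rightarrow> real" where
  "disk_sup_norm f = (SUP z\<in>unit_disk. cmod (f z))"

lemma disk_sup_norm_cong:
  "(\<And>z. z \<in> unit_disk \<Longrightarrow> f z = g z) \<Longrightarrow> disk_sup_norm f = disk_sup_norm g"
  unfolding disk_sup_norm_def by (intro SUP_cong) auto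

lemma disk_sup_norm_upper:
  assumes "bounded (f ` unit_disk)" "z \<in> unit_disk"
  shows "cmod (f z) \<le> disk_sup_norm f"
proof -
  obtain B where "\<And>x. x \<in> unit_disk \<Longrightarrow> cmod (f x) \<le> B"
    using assms(1) by (metis bounded_iff imageI)
  then have "bdd_above ((\<lambda>z. cmod (f z)) ` unit_disk)"
    by (intro bdd_aboveI2)
  then show ?thesis
    unfolding disk_sup_norm_def using assms(2) by (intro cSUP_upper)
qed

lemma disk_sup_norm_least:
  assumes "\<And>z. z \<in> unit_disk \<Longrightarrow> cmod (f z) \<le> B"
  shows "disk_sup_norm f \<le> B"
  unfolding disk_sup_norm_def using assms by (intro cSUP_least) auto

(* HOL functions are total, so the value off the disk is fixed to be 0; this makes each
   bounded analytic function on the disk correspond to exactly one element of the type. *)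
typedef hinf =
  "{f :: complex \<Rightarrow> complex. f holomorphic_on unit_disk \<and> bounded (f ` unit_disk) \<and>
     (\<forall>z. z \<notin> unit_disk \<longrightarrow> f z = 0)}"
  morphisms hinf_fun Abs_hinf
  by (rule exI[of _ "\<lambda>_. 0"]) (auto simp: bounded_iff)

setup_lifting type_definition_hinf

lemma hinf_fun_holomorphic: "hinf_fun f holomorphic_on unit_disk"
  using hinf_fun[of f] by simp

lemma hinf_fun_bounded: "bounded (hinf_fun f ` unit_disk)"
  using hinf_fun[of f] by simp

lemma hinf_fun_outside: "z \<notin> unit_disk \<Longrightarrow> hinf_fun f z = 0"
  using hinf_fun[of f] by blast

lemma hinf_eqI:
  assumes "\<And>z. z \<in> unit_disk \<Longrightarrow> hinf_fun f z = hinf_fun g z"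
  shows "f = g"
  using assms hinf_fun_outside by (metis ext hinf_fun_inject)

definition to_hinf :: "(complex \<Rightarrow> complex) \<Rightarrow> hinf" where
  "to_hinf f = Abs_hinf (\<lambda>z. if z \<in> unit_disk then f z else 0)"

lemma hinf_fun_to_hinf:
  assumes "f holomorphic_on unit_disk" "bounded (f ` unit_disk)" "z \<in> unit_disk"
  shows "hinf_fun (to_hinf f) z = f z"
proof -
  let ?g = "\<lambda>z. if z \<in> unit_disk then f z else 0"
  have "?g holomorphic_on unit_disk"
    using assms(1) by (rule holomorphic_transform) simp
  moreover have "?g ` unit_disk = f ` unit_disk"
    by (rule image_cong) auto
  ultimately have "hinf_fun (Abs_hinf ?g) = ?g"
    using assms(2) by (intro Abs_hinf_inverse) auto
  then show ?thesis
    using assms(3) by (simp add: to_hinf_def)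
qed

instantiation hinf :: real_normed_vector
begin

lift_definition zero_hinf :: hinf is "\<lambda>_. 0"
  by (auto simp: bounded_iff)

lift_definition plus_hinf :: "hinf \<Rightarrow> hinf \<Rightarrow> hinf" is "\<lambda>f g z. f z + g z"
  by (auto intro!: holomorphic_intros bounded_plus_comp)

lift_definition minus_hinf :: "hinf \<Rightarrow> hinf \<Rightarrow> hinf" is "\<lambda>f g z. f z - g z"
  by (auto intro!: holomorphic_intros bounded_minus_comp)

lift_definition uminus_hinf :: "hinf \<Rightarrow> hinf" is "\<lambda>f z. - f z"
  by (auto intro!: holomorphic_intros simp: bounded_iff)

lift_definition scaleR_hinf :: "real \<Rightarrow> hinf \<Rightarrow> hinf" is "\<lambda>r f z. of_real r * f z"
  by (auto intro!: holomorphic_intros bounded_scaleR_comp simp flip: scaleR_conv_of_real)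

lift_definition norm_hinf :: "hinf \<Rightarrow> real" is disk_sup_norm .

definition sgn_hinf :: "hinf \<Rightarrow> hinf" where "sgn_hinf f = scaleR (inverse (norm f)) f"
definition dist_hinf :: "hinf \<Rightarrow> hinf \<Rightarrow> real" where "dist_hinf f g = norm (f - g)"
definition uniformity_hinf :: "(hinf \<times> hinf) filter" where
  "uniformity_hinf = (INF e\<in>{0 <..}. principal {(x, y). dist x y < e})"
definition open_hinf :: "hinf set \<Rightarrow> bool" where
  "open_hinf U = (\<forall>x\<in>U. \<forall>\<^sub>F (x', y) in uniformity. x' = x \<longrightarrow> y \<in> U)"

instance
proof
  fix a b c :: hinf and r s :: real
  show "a + b + c = a + (b + c)" by transfer (simp add: add.assoc)
  show "a + b = b + a" by transfer (simp add: add.commute)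
  show "0 + a = a" by transfer simp
  show "- a + a = 0" by transfer simp
  show "a - b = a + - b" by transfer simp
  show "r *\<^sub>R (a + b) = r *\<^sub>R a + r *\<^sub>R b" by transfer (simp add: algebra_simps)
  show "(r + s) *\<^sub>R a = r *\<^sub>R a + s *\<^sub>R a" by transfer (simp add: algebra_simps)
  show "r *\<^sub>R s *\<^sub>R a = (r * s) *\<^sub>R a" by transfer (simp add: algebra_simps)
  show "1 *\<^sub>R a = a" by transfer simp
  show "sgn a = scaleR (inverse (norm a)) a" by (rule sgn_hinf_def)
  show "dist a b = norm (a - b)" by (rule dist_hinf_def)
  show "uniformity = (INF e\<in>{0 <..}. principal {(x, y :: hinf). dist x y < e})"
    by (rule uniformity_hinf_def)
  show "open U = (\<forall>x\<in>U. \<forall>\<^sub>F (x', y) in uniformity. x' = x \<longrightarrow> y \<in> U)" for U :: "hinf set"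
    by (rule open_hinf_def)
  have upper: "cmod (hinf_fun f z) \<le> norm f" if "z \<in> unit_disk" for f z
    using disk_sup_norm_upper[OF hinf_fun_bounded that] by (simp add: norm_hinf.rep_eq)
  have least: "norm f \<le> B" if "\<And>z. z \<in> unit_disk \<Longrightarrow> cmod (hinf_fun f z) \<le> B" for f B
    using disk_sup_norm_least[OF that] by (simp add: norm_hinf.rep_eq)
  show "norm a = 0 \<longleftrightarrow> a = 0"
  proof
    assume "norm a = 0"
    then have "cmod (hinf_fun a z) \<le> 0" if "z \<in> unit_disk" for z
      using upper[OF that, of a] by simp
    then show "a = 0"
      by (intro hinf_eqI) (simp add: zero_hinf.rep_eq)
  next
    assume "a = 0"
    then show "norm a = 0"
      by (simp add: norm_hinf.rep_eq zero_hinf.rep_eq disk_sup_norm_def)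
  qed
  show "norm (a + b) \<le> norm a + norm b"
    by (rule least) (auto simp: plus_hinf.rep_eq intro!: norm_triangle_le add_mono upper)
  have le: "norm (r *\<^sub>R f) \<le> \<bar>r\<bar> * norm f" for r and f :: hinf
    by (rule least) (auto simp: scaleR_hinf.rep_eq norm_mult intro!: mult_left_mono upper)
  show "norm (r *\<^sub>R a) = \<bar>r\<bar> * norm a"
  proof (cases "r = 0")
    case True
    have nn: "0 \<le> norm (0 *\<^sub>R a)"
      by (rule order_trans[OF norm_ge_zero upper[of 0]]) simp
    show ?thesis using True le[of 0 a] nn by simp
  next
    case False
    have "inverse r *\<^sub>R r *\<^sub>R a = a"
      using False by transfer (simp add: fun_eq_iff)
    then have "norm a \<le> \<bar>inverse r\<bar> * norm (r *\<^sub>R a)"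
      using le[of "inverse r" "r *\<^sub>R a"] by simp
    then have "\<bar>r\<bar> * norm a \<le> norm (r *\<^sub>R a)"
      using False by (simp add: field_simps)
    with le[of r a] show ?thesis by simp
  qed
qed

end

lemma hinf_fun_le_norm: "z \<in> unit_disk \<Longrightarrow> cmod (hinf_fun f z) \<le> norm f"
  using disk_sup_norm_upper[OF hinf_fun_bounded] by (simp add: norm_hinf.rep_eq)

lemma hinf_norm_le:
  "(\<And>z. z \<in> unit_disk \<Longrightarrow> cmod (hinf_fun f z) \<le> B) \<Longrightarrow> norm f \<le> B"
  unfolding norm_hinf.rep_eq by (rule disk_sup_norm_least)

instance hinf :: banach
proof
  fix X :: "nat \<Rightarrow> hinf"
  assume C: "Cauchy X"
  let ?F = "\<lambda>n. hinf_fun (X n)"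
  have "uniformly_Cauchy_on unit_disk ?F"
    unfolding uniformly_Cauchy_on_def
  proof (intro allI impI)
    fix e :: real assume "e > 0"
    then obtain M where M: "\<And>m n. m \<ge> M \<Longrightarrow> n \<ge> M \<Longrightarrow> norm (X m - X n) < e"
      using C by (metis CauchyD)
    have "dist (?F m x) (?F n x) < e" if "x \<in> unit_disk" "m \<ge> M" "n \<ge> M" for x m n
      using hinf_fun_le_norm[OF that(1), of "X m - X n"] M[OF that(2,3)]
      by (simp add: minus_hinf.rep_eq dist_norm)
    then show "\<exists>M. \<forall>x\<in>unit_disk. \<forall>m\<ge>M. \<forall>n\<ge>M. dist (?F m x) (?F n x) < e"
      by blast
  qed
  then obtain l where l: "uniform_limit unit_disk ?F l sequentially"
    using Cauchy_uniformly_convergent uniformly_convergent_on_def by blast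
  have hol: "l holomorphic_on unit_disk"
  proof (rule holomorphic_uniform_sequence[OF open_ball, where f = ?F])
    fix x :: complex assume "x \<in> unit_disk"
    then obtain d where "d > 0" "cball x d \<subseteq> unit_disk"
      using open_contains_cball_eq[OF open_ball] by blast
    then show "\<exists>d>0. cball x d \<subseteq> unit_disk \<and> uniform_limit (cball x d) ?F l sequentially"
      using uniform_limit_on_subset[OF l] by blast
  qed (rule hinf_fun_holomorphic)
  obtain N where N: "\<And>x. x \<in> unit_disk \<Longrightarrow> dist (?F N x) (l x) < 1"
    using uniform_limitD[OF l, of 1] zero_less_one eventually_sequentially order_refl
    by (metis (no_types, lifting))
  have "cmod (l x) \<le> norm (X N) + 1" if "x \<in> unit_disk" for x
  proof -
    have "cmod (l x) \<le> cmod (?F N x) + dist (?F N x) (l x)"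
      using norm_triangle_sub[of "l x" "?F N x"] by (simp add: dist_norm norm_minus_commute)
    then show ?thesis
      using hinf_fun_le_norm[OF that, of "X N"] N[OF that] by linarith
  qed
  then have bd: "bounded (l ` unit_disk)"
    unfolding bounded_iff by blast
  have "X \<longlonglongrightarrow> to_hinf l"
  proof (rule metric_LIMSEQ_I)
    fix e :: real assume "e > 0"
    then obtain M where M: "\<And>n x. n \<ge> M \<Longrightarrow> x \<in> unit_disk \<Longrightarrow> dist (?F n x) (l x) < e / 2"
      using uniform_limitD[OF l, of "e / 2"] half_gt_zero unfolding eventually_sequentially by blast
    have "dist (X n) (to_hinf l) < e" if "n \<ge> M" for n
    proof -
      have "norm (X n - to_hinf l) \<le> e / 2"
        using M[OF that]
        by (intro hinf_norm_le)
          (auto simp: minus_hinf.rep_eq hinf_fun_to_hinf[OF hol bd] dist_norm intro: less_imp_le)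
      then show ?thesis using \<open>e > 0\<close> by (simp add: dist_norm)
    qed
    then show "\<exists>M. \<forall>n\<ge>M. dist (X n) (to_hinf l) < e" by blast
  qed
  then show "convergent X" by (rule convergentI)
qed

lift_definition scaleC_hinf :: "complex \<Rightarrow> hinf \<Rightarrow> hinf" (infixr \<open>*\<^sub>C\<close> 75)
  is "\<lambda>c f z. c * f z"
proof -
  fix c :: complex and f :: "complex \<Rightarrow> complex"
  assume "f holomorphic_on unit_disk \<and> bounded (f ` unit_disk) \<and> (\<forall>z. z \<notin> unit_disk \<longrightarrow> f z = 0)"
  moreover from this have "bounded ((\<lambda>w. c * w) ` f ` unit_disk)"
    by (blast intro: bounded_linear_image bounded_linear_mult_right)
  ultimately show "(\<lambda>z. c * f z) holomorphic_on unit_disk \<and> bounded ((\<lambda>z. c * f z) ` unit_disk) \<and>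
      (\<forall>z. z \<notin> unit_disk \<longrightarrow> c * f z = 0)"
    by (auto intro!: holomorphic_intros simp: image_image)
qed

(* Meaningful only for an analytic self-map, where composition stays in the space. *)
definition composition_op :: "(complex \<Rightarrow> complex) \<Rightarrow> hinf \<Rightarrow> hinf" where
  "composition_op \<phi> f = to_hinf (hinf_fun f \<circ> \<phi>)"

lemma hinf_fun_composition_op:
  assumes "analytic_self_map \<phi>" "z \<in> unit_disk"
  shows "hinf_fun (composition_op \<phi> f) z = hinf_fun f (\<phi> z)"
proof -
  have maps: "\<phi> ` unit_disk \<subseteq> unit_disk" and hol: "\<phi> holomorphic_on unit_disk"
    using assms(1) by (simp_all add: analytic_self_map_def)
  have "(hinf_fun f \<circ> \<phi>) holomorphic_on unit_disk"
    by (rule holomorphic_on_compose_gen[OF hol hinf_fun_holomorphic maps])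
  moreover have "bounded ((hinf_fun f \<circ> \<phi>) ` unit_disk)"
    unfolding image_comp[symmetric]
    by (rule bounded_subset[OF hinf_fun_bounded image_mono[OF maps]])
  ultimately show ?thesis
    using assms(2) by (simp add: composition_op_def hinf_fun_to_hinf)
qed

definition compact_operator :: "('a::real_normed_vector \<Rightarrow> 'b::real_normed_vector) \<Rightarrow> bool" where
  "compact_operator T \<longleftrightarrow>
     bounded_linear T \<and> (\<forall>B. bounded B \<longrightarrow> compact (closure (T ` B)))"

end

theory Submission
  imports Defs
begin

text \<open>
  Write \<open>T\<close> for the operator and \<open>p\<^sub>n = \<lambda>\<^sub>1\<phi>\<^sub>1\<^sup>n + \<dots> + \<lambda>\<^sub>k\<phi>\<^sub>k\<^sup>n\<close>, so that \<open>p\<^sub>n\<close> is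
  the image under \<open>T\<close> of the monomial of degree \<open>n\<close>. The monomials lie in the unit ball and
  \<open>p\<^sub>n\<close> tends to \<open>0\<close> pointwise, so if \<open>T\<close> is compact then every norm limit of a
  subsequence of \<open>p\<^sub>n\<close> is \<open>0\<close>, and hence \<open>p\<^sub>n\<close> tends to \<open>0\<close> in norm.

  Conversely, let \<open>\<parallel>p\<^sub>n\<parallel> \<le> e\<close> for all \<open>n \<ge> N\<close>. If \<open>g(w) = \<Sum>d\<^sub>n w\<^sup>n\<close> with
  \<open>\<Sum>\<bar>d\<^sub>n\<bar> \<le> M\<close>, then applying \<open>T\<close> term by term to \<open>w\<^sup>N g(w)\<close> gives a function
  bounded by \<open>e M\<close>. A general bounded analytic \<open>f\<close> has no such absolutely convergent
  expansion, but the value of \<open>T f\<close> at one point \<open>z\<close> only involves \<open>f\<close> at the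
  \<open>k\<close> nodes \<open>\<phi>\<^sub>i(z)\<close>, and on any \<open>k\<close> nodes \<open>f\<close> agrees with a function
  \<open>g\<close> whose coefficients have absolute sum at most \<open>7\<^sup>k \<parallel>f\<parallel>\<close>, a bound that does not
  depend on the nodes (\<open>wiener_interpolation\<close>). This is Newton interpolation with Blaschke
  factors in place of linear factors: \<open>f = f(a) + b\<^sub>a h\<close> where \<open>\<parallel>h\<parallel> \<le> 2\<parallel>f\<parallel>\<close> by the
  Schwarz lemma, and the coefficients of \<open>b\<^sub>a\<close> have absolute sum at most \<open>3\<close> for every
  \<open>a\<close> in the disk.

  Splitting off a Taylor polynomial, \<open>f = \<Sum>\<^bsub>j<N\<^esub> c\<^sub>j w\<^sup>j + w\<^sup>N q\<close> with
  \<open>\<parallel>q\<parallel> \<le> \<parallel>f\<parallel> + \<Sum>\<^bsub>j<N\<^esub> \<bar>c\<^sub>j\<bar>\<close>, and interpolating \<open>q\<close> at the nodes yields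
  \<open>\<parallel>T f\<parallel> \<le> 7\<^sup>k e \<parallel>f\<parallel> + K \<Sum>\<^bsub>j<N\<^esub> \<bar>c\<^sub>j\<bar>\<close> (\<open>norm_comp_sum_le\<close>). As \<open>e\<close> is
  arbitrary, \<open>T\<close> is small modulo finitely many bounded functionals and therefore compact
  (\<open>compact_operator_if_small_modulo_functionals\<close>).
\<close>

section \<open>Functions with absolutely convergent Taylor series\<close>

text \<open>
  On the disk, \<open>g\<close> is the sum of a power series whose coefficients have absolute sum at most
  \<open>M\<close>; that is, \<open>g\<close> has norm at most \<open>M\<close> in the Wiener algebra. Values of \<open>g\<close>
  outside the disk are irrelevant.
\<close>
definition wiener_bounded :: "(complex \<Rightarrow> complex) \<Rightarrow> real \<Rightarrow> bool" where
  "wiener_bounded g M \<longleftrightarrow> (\<exists>d. summable (\<lambda>n. cmod (d n)) \<and> (\<Sum>n. cmod (d n)) \<le> M \<and>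
     (\<forall>w\<in>unit_disk. (\<lambda>n. d n * w ^ n) sums g w))"

lemma wiener_bounded_const: "wiener_bounded (\<lambda>_. c) (cmod c)"
proof -
  let ?d = "\<lambda>n::nat. if n = 0 then c else 0"
  have "(\<lambda>n. cmod (?d n)) sums cmod c"
    using sums_single[of 0 "\<lambda>_. cmod c"] by (simp add: if_distrib cong: if_cong)
  moreover have "(\<lambda>n. ?d n * w ^ n) sums c" for w
    using sums_single[of 0 "\<lambda>_. c"]
    by (rule sums_cong[THEN iffD1, rotated]) auto
  ultimately show ?thesis
    unfolding wiener_bounded_def by (intro exI[of _ ?d]) (auto simp: sums_iff)
qed

lemma wiener_bounded_mono: "wiener_bounded g M \<Longrightarrow> M \<le> M' \<Longrightarrow> wiener_bounded g M'"
  unfolding wiener_bounded_def by (meson order_trans)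

lemma wiener_bounded_add:
  assumes "wiener_bounded g M" "wiener_bounded h L"
  shows "wiener_bounded (\<lambda>w. g w + h w) (M + L)"
proof -
  obtain d where d: "summable (\<lambda>n. cmod (d n))" "(\<Sum>n. cmod (d n)) \<le> M"
      "\<And>w. w \<in> unit_disk \<Longrightarrow> (\<lambda>n. d n * w ^ n) sums g w"
    using assms(1) unfolding wiener_bounded_def by blast
  obtain e where e: "summable (\<lambda>n. cmod (e n))" "(\<Sum>n. cmod (e n)) \<le> L"
      "\<And>w. w \<in> unit_disk \<Longrightarrow> (\<lambda>n. e n * w ^ n) sums h w"
    using assms(2) unfolding wiener_bounded_def by blast
  have s: "summable (\<lambda>n. cmod (d n + e n))"
    by (rule summable_comparison_test'[OF summable_add[OF d(1) e(1)], of 0])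
      (simp add: norm_triangle_ineq)
  have "(\<Sum>n. cmod (d n + e n)) \<le> (\<Sum>n. cmod (d n) + cmod (e n))"
    by (rule suminf_le[OF norm_triangle_ineq s summable_add[OF d(1) e(1)]])
  also have "\<dots> \<le> M + L"
    using d(2) e(2) by (simp add: suminf_add[OF d(1) e(1), symmetric])
  finally have "(\<Sum>n. cmod (d n + e n)) \<le> M + L" .
  moreover have "(\<lambda>n. (d n + e n) * w ^ n) sums (g w + h w)" if "w \<in> unit_disk" for w
    using sums_add[OF d(3)[OF that] e(3)[OF that]] by (simp add: distrib_right)
  ultimately show ?thesis
    unfolding wiener_bounded_def using s by (intro exI[of _ "\<lambda>n. d n + e n"]) blast
qed

lemma wiener_bounded_mult:
  assumes "wiener_bounded g M" "wiener_bounded h L"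
  shows "wiener_bounded (\<lambda>w. g w * h w) (M * L)"
proof -
  obtain d where d: "summable (\<lambda>n. cmod (d n))" "(\<Sum>n. cmod (d n)) \<le> M"
      "\<And>w. w \<in> unit_disk \<Longrightarrow> (\<lambda>n. d n * w ^ n) sums g w"
    using assms(1) unfolding wiener_bounded_def by blast
  obtain e where e: "summable (\<lambda>n. cmod (e n))" "(\<Sum>n. cmod (e n)) \<le> L"
      "\<And>w. w \<in> unit_disk \<Longrightarrow> (\<lambda>n. e n * w ^ n) sums h w"
    using assms(2) unfolding wiener_bounded_def by blast
  let ?p = "\<lambda>n. \<Sum>i\<le>n. d i * e (n - i)"
  let ?P = "\<lambda>n. \<Sum>i\<le>n. cmod (d i) * cmod (e (n - i))"
  have P: "?P sums ((\<Sum>n. cmod (d n)) * (\<Sum>n. cmod (e n)))"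
    using d(1) e(1) by (intro Cauchy_product_sums) simp_all
  have le: "cmod (?p n) \<le> ?P n" for n
    by (rule sum_norm_le) (simp add: norm_mult)
  have s: "summable (\<lambda>n. cmod (?p n))"
    by (rule summable_comparison_test'[OF sums_summable[OF P], of 0])
      (simp only: real_norm_def abs_norm_cancel le)
  have "(\<Sum>n. cmod (?p n)) \<le> (\<Sum>n. ?P n)"
    by (rule suminf_le[OF le s sums_summable[OF P]])
  also have "\<dots> = (\<Sum>n. cmod (d n)) * (\<Sum>n. cmod (e n))"
    using P by (simp add: sums_iff)
  also have "\<dots> \<le> M * L"
    using d(1,2) e(1,2)
    by (intro mult_mono) (auto intro: suminf_nonneg order_trans[OF suminf_nonneg])
  finally have M: "(\<Sum>n. cmod (?p n)) \<le> M * L" .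
  have abs: "summable (\<lambda>n. cmod (c n * w ^ n))"
    if "summable (\<lambda>n. cmod (c n))" "w \<in> unit_disk" for c w
    by (rule summable_comparison_test'[OF that(1), of 0])
      (use that(2) in \<open>auto simp: norm_mult norm_power power_le_one intro: mult_left_le\<close>)
  have "(\<lambda>n. ?p n * w ^ n) sums (g w * h w)" if w: "w \<in> unit_disk" for w
  proof -
    have "(\<lambda>n. \<Sum>i\<le>n. (d i * w ^ i) * (e (n - i) * w ^ (n - i)))
        sums ((\<Sum>n. d n * w ^ n) * (\<Sum>n. e n * w ^ n))"
      by (rule Cauchy_product_sums[OF abs[OF d(1) w] abs[OF e(1) w]])
    moreover have "(\<Sum>i\<le>n. (d i * w ^ i) * (e (n - i) * w ^ (n - i))) = ?p n * w ^ n" for n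
      unfolding sum_distrib_right
    proof (intro sum.cong refl)
      fix i assume "i \<in> {..n}"
      then have "w ^ n = w ^ i * w ^ (n - i)"
        by (simp flip: power_add)
      then show "(d i * w ^ i) * (e (n - i) * w ^ (n - i)) = d i * e (n - i) * w ^ n"
        by simp
    qed
    ultimately show ?thesis
      using d(3)[OF w] e(3)[OF w] by (simp add: sums_iff)
  qed
  then show ?thesis
    unfolding wiener_bounded_def using s M by (intro exI[of _ ?p]) blast
qed

text \<open>
  The coefficients of the Blaschke factor \<open>(w - a) / (1 - a\<^sup>* w)\<close>, with \<open>a\<^sup>*\<close> the conjugate
  of \<open>a\<close>, have absolute sum \<open>1 + 2\<bar>a\<bar>\<close>.
  It is essential that this stays bounded as \<open>a\<close> approaches the circle.
\<close>
lemma wiener_bounded_Moebius: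
  assumes "cmod a < 1"
  shows "wiener_bounded (Moebius_function 0 a) 3"
proof -
  \<comment> \<open>The expansion comes from \<open>b\<^sub>a(w) = - a + (1 - \<bar>a\<bar>\<^sup>2) w / (1 - a\<^sup>* w)\<close>.\<close>
  let ?d = "\<lambda>n. case n of 0 \<Rightarrow> - a | Suc m \<Rightarrow> (1 - of_real (cmod a ^ 2)) * cnj a ^ m"
  have a2: "0 \<le> 1 - cmod a ^ 2"
    using assms by (simp add: power_le_one)
  have c: "cmod (1 - of_real (cmod a ^ 2)) = 1 - cmod a ^ 2"
    using a2 by (metis norm_of_real of_real_1 of_real_diff abs_of_nonneg)
  have "(\<lambda>m. (1 - cmod a ^ 2) * cmod a ^ m) sums ((1 - cmod a ^ 2) * (1 / (1 - cmod a)))"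
    using assms by (intro sums_mult geometric_sums) simp
  also have "(1 - cmod a ^ 2) * (1 / (1 - cmod a)) = 1 + cmod a"
    using assms by (simp add: field_simps power2_eq_square)
  finally have "(\<lambda>m. cmod (?d (Suc m))) sums (1 + cmod a)"
    using c by (simp add: norm_mult norm_power)
  from sums_Suc[OF this] have n: "(\<lambda>n. cmod (?d n)) sums (1 + cmod a + cmod a)"
    by (simp only: nat.case norm_minus_cancel)
  have "(\<lambda>n. ?d n * w ^ n) sums Moebius_function 0 a w" if w: "w \<in> unit_disk" for w
  proof -
    have lt: "cmod (cnj a * w) < 1"
      using assms w norm_mult_less[of "cnj a" 1 w 1] by simp
    then have ne: "1 - cnj a * w \<noteq> 0"
      by auto
    have "(\<lambda>m. (1 - of_real (cmod a ^ 2)) * w * (cnj a * w) ^ m)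
        sums ((1 - of_real (cmod a ^ 2)) * w * (1 / (1 - cnj a * w)))"
      by (intro sums_mult geometric_sums lt)
    then have "(\<lambda>m. ?d (Suc m) * w ^ Suc m)
        sums ((1 - of_real (cmod a ^ 2)) * w * (1 / (1 - cnj a * w)))"
      by (simp add: power_mult_distrib algebra_simps)
    from sums_Suc[OF this] have "(\<lambda>n. ?d n * w ^ n)
        sums ((1 - of_real (cmod a ^ 2)) * w * (1 / (1 - cnj a * w)) + - a)"
      by (simp only: nat.case power_0 mult_1_right)
    also have "(1 - of_real (cmod a ^ 2)) * w * (1 / (1 - cnj a * w)) + - a
        = Moebius_function 0 a w"
    proof -
      have "of_real (cmod a ^ 2) = a * cnj a"
        by (rule complex_norm_square)
      then show ?thesis
        using ne unfolding Moebius_function_simple by (simp add: field_simps)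
    qed
    finally show ?thesis .
  qed
  moreover have "(\<Sum>n. cmod (?d n)) \<le> 3"
    using sums_unique[OF n] assms by linarith
  ultimately show ?thesis
    unfolding wiener_bounded_def using sums_summable[OF n] by blast
qed

section \<open>Division by Blaschke factors and interpolation\<close>

text \<open>
  A form of the Schwarz lemma: dividing by the coordinate does not increase the supremum bound.
\<close>
lemma norm_le_if_norm_times_id_le:
  assumes hol: "q holomorphic_on unit_disk"
    and le: "\<And>z. z \<in> unit_disk \<Longrightarrow> cmod (z * q z) \<le> M" and z: "z \<in> unit_disk"
  shows "cmod (q z) \<le> M"
proof (rule field_le_epsilon)
  \<comment> \<open>Dividing by \<open>M + e\<close> rather than \<open>M\<close> gives the strict bound by \<open>1\<close> that the
    Schwarz lemma requires, also when \<open>M = 0\<close>.\<close>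
  fix e :: real assume "e > 0"
  have "M \<ge> 0"
    using le[of 0] by simp
  with \<open>e > 0\<close> have pos: "M + e > 0"
    by simp
  let ?f = "\<lambda>z. z * q z / of_real (M + e)"
  have f: "?f holomorphic_on unit_disk"
    using pos hol by (intro holomorphic_intros) (auto simp flip: of_real_add)
  have lt: "cmod (?f w) < 1" if "cmod w < 1" for w
  proof -
    have "cmod (?f w) = cmod (w * q w) / (M + e)"
      using pos by (simp add: norm_divide del: of_real_add)
    also have "\<dots> < 1"
      using le[of w] that pos \<open>e > 0\<close> by (simp add: field_simps)
    finally show ?thesis .
  qed
  have schwarz: "cmod (?f w) \<le> cmod w" "cmod (deriv ?f 0) \<le> 1" if "cmod w < 1" for w
    using Schwarz_Lemma(1,2)[OF f _ lt that] by auto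
  show "cmod (q z) \<le> M + e"
  proof (cases "z = 0")
    case False
    have "cmod z * (cmod (q z) / (M + e)) \<le> cmod z * 1"
      using schwarz(1)[of z] z pos by (simp add: norm_divide norm_mult del: of_real_add)
    then have "cmod (q z) / (M + e) \<le> 1"
      using False by (simp only: mult_le_cancel_left_pos zero_less_norm_iff not_False_eq_True)
    then show ?thesis
      using pos by (simp add: field_simps)
  next
    case True
    obtain q' where "(q has_field_derivative q') (at 0)"
      using hol holomorphic_on_imp_differentiable_at[of q unit_disk 0]
      by (auto simp: field_differentiable_def)
    then have "(?f has_field_derivative q 0 / of_real (M + e)) (at 0)"
      using pos by (auto intro!: derivative_eq_intros simp flip: of_real_add)
    then have "cmod (q 0 / of_real (M + e)) \<le> 1"
      using schwarz(2)[of 0] by (simp add: DERIV_imp_deriv del: of_real_add)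
    then show ?thesis
      using True pos by (simp add: norm_divide del: of_real_add)
  qed
qed

lemma norm_le_if_norm_times_power_le:
  assumes "q holomorphic_on unit_disk" "\<And>z. z \<in> unit_disk \<Longrightarrow> cmod (z ^ N * q z) \<le> M"
    "z \<in> unit_disk"
  shows "cmod (q z) \<le> M"
  using assms(2,3)
proof (induction N arbitrary: z)
  case (Suc N)
  have "cmod (w ^ N * q w) \<le> M" if "w \<in> unit_disk" for w
  proof (rule norm_le_if_norm_times_id_le[OF _ _ that])
    show "(\<lambda>z. z ^ N * q z) holomorphic_on unit_disk"
      using assms(1) by (intro holomorphic_intros)
    show "cmod (z * (z ^ N * q z)) \<le> M" if "z \<in> unit_disk" for z
      using Suc.prems(1)[OF that] by (simp add: mult.assoc)
  qed
  then show ?case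
    using Suc.IH Suc.prems(2) by blast
qed simp

text \<open>
  The quotient of \<open>f - f a\<close> by the Blaschke factor at \<open>a\<close>. The automorphism of the disk that
  takes \<open>a\<close> to \<open>0\<close> reduces the bound to division by the coordinate.
\<close>
lemma Moebius_division:
  assumes hol: "f holomorphic_on unit_disk"
    and le: "\<And>z. z \<in> unit_disk \<Longrightarrow> cmod (f z) \<le> M" and a: "a \<in> unit_disk"
  obtains h where "h holomorphic_on unit_disk"
    "\<And>z. z \<in> unit_disk \<Longrightarrow> cmod (h z) \<le> 2 * M"
    "\<And>z. z \<in> unit_disk \<Longrightarrow> f z = f a + Moebius_function 0 a z * h z"
proof -
  let ?b = "Moebius_function 0 a" and ?b' = "Moebius_function 0 (- a)"
  let ?G = "\<lambda>u. f (?b' u) - f a"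
  have a1: "cmod a < 1" "cmod (- a) < 1"
    using a by auto
  have maps: "?b z \<in> unit_disk" "?b' z \<in> unit_disk" if "z \<in> unit_disk" for z
    using Moebius_function_norm_lt_1[OF a1(1), of z] Moebius_function_norm_lt_1[OF a1(2), of z]
      that by auto
  have "(f \<circ> ?b') holomorphic_on unit_disk"
    using maps by (intro holomorphic_on_compose_gen[OF Moebius_function_holomorphic[OF a1(2)] hol])
      blast
  then have G: "?G holomorphic_on unit_disk"
    unfolding comp_def by (intro holomorphic_intros)
  have "?b' 0 = a"
    by (simp add: Moebius_function_of_zero)
  then obtain H where H: "H holomorphic_on unit_disk" "\<And>u. cmod u < 1 \<Longrightarrow> ?G u = u * H u"
    using Schwarz3[OF G] by auto
  have "cmod (u * H u) \<le> 2 * M" if "u \<in> unit_disk" for u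
    using H(2)[of u] norm_triangle_ineq4[of "f (?b' u)" "f a"] le[OF maps(2)[OF that]] le[OF a] that
    by simp
  then have Hle: "cmod (H u) \<le> 2 * M" if "u \<in> unit_disk" for u
    using norm_le_if_norm_times_id_le[OF H(1) _ that] by blast
  show ?thesis
  proof
    show "(H \<circ> ?b) holomorphic_on unit_disk"
      using maps by (intro holomorphic_on_compose_gen[OF Moebius_function_holomorphic[OF a1(1)] H(1)])
        blast
    show "cmod ((H \<circ> ?b) z) \<le> 2 * M" if "z \<in> unit_disk" for z
      using Hle[OF maps(1)[OF that]] by simp
    show "f z = f a + ?b z * (H \<circ> ?b) z" if "z \<in> unit_disk" for z
    proof -
      have "?b' (?b z) = z"
        using that a1 by (intro Moebius_function_compose) auto
      then show ?thesis
        using H(2)[of "?b z"] maps(1)[OF that] by (simp add: algebra_simps)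
    qed
  qed
qed

text \<open>
  Any values of a bounded analytic function on finitely many nodes are also taken by a function
  in the Wiener algebra, with a norm bound that depends only on the number of nodes.
\<close>
lemma wiener_interpolation:
  assumes "f holomorphic_on unit_disk" "\<And>z. z \<in> unit_disk \<Longrightarrow> cmod (f z) \<le> M"
    "set as \<subseteq> unit_disk"
  shows "\<exists>g. wiener_bounded g (7 ^ length as * M) \<and> (\<forall>a\<in>set as. g a = f a)"
  using assms
proof (induction as arbitrary: f M)
  case Nil
  have "0 \<le> M"
    using Nil(2)[of 0] norm_ge_zero[of "f 0"] by (simp del: norm_ge_zero)
  then show ?case
    using wiener_bounded_mono[OF wiener_bounded_const[of 0]] by auto
next
  case (Cons a as)
  have M: "0 \<le> M"
    using Cons.prems(2)[of 0] norm_ge_zero[of "f 0"] by (simp del: norm_ge_zero)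
  have a: "a \<in> unit_disk"
    using Cons.prems(3) by simp
  obtain h where h: "h holomorphic_on unit_disk" "\<And>z. z \<in> unit_disk \<Longrightarrow> cmod (h z) \<le> 2 * M"
    "\<And>z. z \<in> unit_disk \<Longrightarrow> f z = f a + Moebius_function 0 a z * h z"
    using Moebius_division[OF Cons.prems(1,2) a] by blast
  obtain g where g: "wiener_bounded g (7 ^ length as * (2 * M))" "\<And>x. x \<in> set as \<Longrightarrow> g x = h x"
    using Cons.IH[OF h(1,2)] Cons.prems(3) by auto
  \<comment> \<open>The Blaschke factor vanishes at \<open>a\<close>, and \<open>g\<close> agrees with the quotient \<open>h\<close> at the
    remaining nodes. The norm is at most \<open>M + 3 (7\<^sup>m 2 M) \<le> 7\<^bsup>m+1\<^esup> M\<close>, where \<open>m\<close> is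
    their number.\<close>
  let ?g = "\<lambda>w. f a + Moebius_function 0 a w * g w"
  have "wiener_bounded ?g (cmod (f a) + 3 * (7 ^ length as * (2 * M)))"
    using a by (intro wiener_bounded_add wiener_bounded_const wiener_bounded_mult
        wiener_bounded_Moebius g(1)) simp
  moreover have "cmod (f a) + 3 * (7 ^ length as * (2 * M)) \<le> 7 ^ length (a # as) * M"
  proof -
    have "M \<le> 7 ^ length as * M"
      using mult_right_mono[OF _ M, of 1 "7 ^ length as"] by simp
    then show ?thesis
      using Cons.prems(2)[OF a] by (simp add: algebra_simps)
  qed
  ultimately have "wiener_bounded ?g (7 ^ length (a # as) * M)"
    by (rule wiener_bounded_mono)
  moreover have "?g x = f x" if "x \<in> set (a # as)" for x
  proof (cases "x = a")
    case False
    then show ?thesis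
      using that g(2)[of x] h(3)[of x] Cons.prems(3) by auto
  qed (simp add: Moebius_function_eq_zero)
  ultimately show ?case
    by blast
qed

section \<open>Taylor coefficients\<close>

text \<open>The coefficient of \<open>z\<^sup>j\<close> in the Taylor expansion of \<open>f\<close> at the origin.\<close>
definition taylor_coeff :: "nat \<Rightarrow> hinf \<Rightarrow> complex" where
  "taylor_coeff j f = (deriv ^^ j) (hinf_fun f) 0 / fact j"

lemma taylor_coeff_diff: "taylor_coeff j (f - g) = taylor_coeff j f - taylor_coeff j g"
proof -
  have "hinf_fun (f - g) = (\<lambda>z. hinf_fun f z - hinf_fun g z)"
    by (rule minus_hinf.rep_eq)
  then have "(deriv ^^ j) (hinf_fun (f - g)) 0
      = (deriv ^^ j) (hinf_fun f) 0 - (deriv ^^ j) (hinf_fun g) 0"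
    using higher_deriv_diff[OF hinf_fun_holomorphic hinf_fun_holomorphic open_ball]
    by simp
  then show ?thesis
    by (simp add: taylor_coeff_def diff_divide_distrib)
qed

lemma norm_taylor_coeff_le: "cmod (taylor_coeff j f) \<le> 2 ^ j * norm f"
proof -
  have "cmod ((deriv ^^ j) (hinf_fun f) 0) \<le> fact j * norm f / (1 / 2) ^ j"
  proof (rule Cauchy_inequality)
    have "cball 0 (1 / 2) \<subseteq> unit_disk"
      by auto
    then show "continuous_on (cball 0 (1 / 2)) (hinf_fun f)"
      using hinf_fun_holomorphic holomorphic_on_imp_continuous_on continuous_on_subset by blast
    show "hinf_fun f holomorphic_on ball 0 (1 / 2)"
      by (rule holomorphic_on_subset[OF hinf_fun_holomorphic]) auto
    show "cmod (hinf_fun f x) \<le> norm f" if "cmod (0 - x) = 1 / 2" for x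
      using that by (intro hinf_fun_le_norm) simp
  qed simp
  then show ?thesis
    by (simp add: taylor_coeff_def norm_divide field_simps power_divide)
qed

text \<open>
  The bound on \<open>q\<close> has the factor \<open>1\<close> in front of the norm of \<open>f\<close>, whatever \<open>N\<close> is:
  it is a bound on \<open>z\<^sup>N q z\<close>, and the Schwarz lemma transfers it to \<open>q\<close>. This
  uniformity matters because \<open>N\<close> depends on the accuracy wanted in the estimate of the operator.
\<close>
lemma taylor_remainder:
  obtains q where "q holomorphic_on unit_disk"
    "\<And>z. z \<in> unit_disk \<Longrightarrow>
       hinf_fun f z = (\<Sum>j<N. taylor_coeff j f * z ^ j) + z ^ N * q z"
    "\<And>z. z \<in> unit_disk \<Longrightarrow> cmod (q z) \<le> norm f + (\<Sum>j<N. cmod (taylor_coeff j f))"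
proof -
  let ?c = "\<lambda>j. taylor_coeff j f"
  have f: "(\<lambda>n. ?c n * z ^ n) sums hinf_fun f z" if "z \<in> unit_disk" for z
    using holomorphic_power_series[OF hinf_fun_holomorphic that, of f]
    by (simp add: taylor_coeff_def)
  \<comment> \<open>A power series for \<open>q\<close>, rather than a quotient by \<open>z\<^sup>N\<close>, so that it is analytic at
    the origin.\<close>
  define q where "q z = (\<Sum>n. ?c (n + N) * z ^ n)" for z
  have q: "(\<lambda>n. ?c (n + N) * z ^ n) sums q z" if z: "z \<in> unit_disk" for z
  proof (cases "z = 0")
    case False
    have "summable (\<lambda>n. ?c (n + N) * z ^ (n + N))"
      using summable_iff_shift[of "\<lambda>n. ?c n * z ^ n" N] f[OF z] by (simp add: sums_iff)
    then have "summable (\<lambda>n. inverse (z ^ N) * (?c (n + N) * z ^ (n + N)))"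
      by (rule summable_mult)
    then have "summable (\<lambda>n. ?c (n + N) * z ^ n)"
      using False by (simp add: power_add field_simps)
    then show ?thesis
      unfolding q_def by (rule summable_sums)
  qed (simp add: q_def summable_sums)
  have hol: "q holomorphic_on unit_disk"
    using q by (intro power_series_holomorphic[of 0 1 "\<lambda>n. ?c (n + N)"]) simp
  have eq: "hinf_fun f z = (\<Sum>j<N. ?c j * z ^ j) + z ^ N * q z" if z: "z \<in> unit_disk" for z
  proof -
    have "(\<lambda>n. z ^ N * (?c (n + N) * z ^ n)) sums (z ^ N * q z)"
      by (intro sums_mult q z)
    then have "(\<lambda>n. ?c (n + N) * z ^ (n + N)) sums (z ^ N * q z)"
      by (simp add: power_add algebra_simps)
    moreover have "(\<lambda>n. ?c (n + N) * z ^ (n + N)) sums (hinf_fun f z - (\<Sum>j<N. ?c j * z ^ j))"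
      using sums_split_initial_segment[OF f[OF z]] .
    ultimately have "z ^ N * q z = hinf_fun f z - (\<Sum>j<N. ?c j * z ^ j)"
      by (rule sums_unique2)
    then show ?thesis
      by simp
  qed
  have "cmod (z ^ N * q z) \<le> norm f + (\<Sum>j<N. cmod (?c j))" if z: "z \<in> unit_disk" for z
  proof -
    have "cmod (\<Sum>j<N. ?c j * z ^ j) \<le> (\<Sum>j<N. cmod (?c j))"
      using z by (intro sum_norm_le)
        (auto simp: norm_mult norm_power power_le_one intro: mult_left_le)
    moreover have "z ^ N * q z = hinf_fun f z - (\<Sum>j<N. ?c j * z ^ j)"
      using eq[OF z] by simp
    ultimately show ?thesis
      using norm_triangle_ineq4[of "hinf_fun f z" "\<Sum>j<N. ?c j * z ^ j"] hinf_fun_le_norm[OF z, of f]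
      by simp
  qed
  then have "cmod (q z) \<le> norm f + (\<Sum>j<N. cmod (?c j))" if "z \<in> unit_disk" for z
    using norm_le_if_norm_times_power_le[OF hol _ that] by blast
  with hol eq show ?thesis
    using that by blast
qed

section \<open>A compactness criterion\<close>

text \<open>
  Finitely many members of \<open>B\<close> approximate all of \<open>B\<close> as far as the first \<open>N\<close> functions
  \<open>c j\<close> can tell.
\<close>
lemma finite_net_for_functionals:
  fixes c :: "nat \<Rightarrow> 'a \<Rightarrow> complex"
  assumes "\<And>j. bounded (c j ` B)" "\<delta> > 0"
  obtains F where "finite F" "F \<subseteq> B" "\<And>f. f \<in> B \<Longrightarrow> \<exists>g\<in>F. \<forall>j<N. cmod (c j f - c j g) < \<delta>"
proof -
  have net: "\<exists>D. finite D \<and> c j ` B \<subseteq> (\<Union>d\<in>D. ball d (\<delta> / 2))" for j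
  proof -
    have "compact (closure (c j ` B))"
      using assms(1) by simp
    then obtain D where "finite D" "closure (c j ` B) \<subseteq> (\<Union>d\<in>D. ball d (\<delta> / 2))"
      using assms(2) unfolding compact_eq_totally_bounded by (meson half_gt_zero)
    then show ?thesis
      using order_trans[OF closure_subset] by (intro exI[of _ D] conjI)
  qed
  define D where "D j = (SOME D. finite D \<and> c j ` B \<subseteq> (\<Union>d\<in>D. ball d (\<delta> / 2)))" for j
  have D: "finite (D j) \<and> c j ` B \<subseteq> (\<Union>d\<in>D j. ball d (\<delta> / 2))" for j
    unfolding D_def by (rule someI_ex[OF net])
  define s where "s j f = (SOME d. d \<in> D j \<and> cmod (c j f - d) < \<delta> / 2)" for j f
  have s: "s j f \<in> D j \<and> cmod (c j f - s j f) < \<delta> / 2" if "f \<in> B" for j f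
  proof -
    have "c j f \<in> (\<Union>d\<in>D j. ball d (\<delta> / 2))"
      using D[of j] that by blast
    then obtain d where "d \<in> D j" "dist d (c j f) < \<delta> / 2"
      by (auto simp only: UN_iff mem_ball)
    then have "\<exists>d. d \<in> D j \<and> cmod (c j f - d) < \<delta> / 2"
      by (intro exI[of _ d]) (simp add: dist_norm norm_minus_commute)
    then show ?thesis
      unfolding s_def by (rule someI_ex)
  qed
  \<comment> \<open>Members of \<open>B\<close> with the same list of nearby centres have values within \<open>\<delta>\<close> of each
    other, and only finitely many lists occur; one representative of each suffices.\<close>
  define sig where "sig f = (\<lambda>j\<in>{..<N}. s j f)" for f
  have "sig ` B \<subseteq> PiE {..<N} D"
    unfolding sig_def using s by (intro image_subsetI restrict_PiE_iff[THEN iffD2] ballI) blast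
  then have "finite (sig ` B)"
    using D finite_PiE[of "{..<N}" D] finite_subset by blast
  then obtain F where F: "F \<subseteq> B" "finite F" "sig ` B = sig ` F"
    by (rule finite_subset_image[OF _ order_refl, THEN exE]) blast
  have "\<exists>g\<in>F. \<forall>j<N. cmod (c j f - c j g) < \<delta>" if f: "f \<in> B" for f
  proof -
    from f have "sig f \<in> sig ` F"
      unfolding F(3)[symmetric] by (rule imageI)
    then obtain g where g: "sig f = sig g" "g \<in> F"
      by (rule imageE)
    have "cmod (c j f - c j g) < \<delta>" if "j < N" for j
    proof -
      have "s j f = s j g"
        using fun_cong[OF g(1), of j] that by (simp add: sig_def)
      moreover have "cmod (c j f - s j f) < \<delta> / 2" "cmod (c j g - s j g) < \<delta> / 2"
        using s f g(2) F(1) by blast+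
      ultimately show ?thesis
        using norm_triangle_ineq4[of "c j f - s j f" "c j g - s j g"] by simp
    qed
    then show ?thesis
      using g(2) by blast
  qed
  then show ?thesis
    using that F by blast
qed

text \<open>
  An operator into a Banach space is compact if, for each \<open>e > 0\<close>, its norm is at most \<open>e\<close>
  times that of the argument up to a term controlled by finitely many bounded functionals: a net
  for the functionals is then a net for the image. Of the functionals, only boundedness and
  compatibility with differences are needed.
\<close>
lemma compact_operator_if_small_modulo_functionals:
  fixes T :: "'a::real_normed_vector \<Rightarrow> 'b::banach" and c :: "nat \<Rightarrow> 'a \<Rightarrow> complex"
  assumes T: "bounded_linear T"
    and diff: "\<And>j f g. c j (f - g) = c j f - c j g"
    and bdd: "\<And>j f. cmod (c j f) \<le> C j * norm f"
    and small: "\<And>e. e > 0 \<Longrightarrow>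
      \<exists>N K. \<forall>f. norm (T f) \<le> e * norm f + K * (\<Sum>j<N. cmod (c j f))"
  shows "compact_operator T"
  unfolding compact_operator_def compact_eq_totally_bounded
proof (intro conjI allI impI T)
  fix B :: "'a set" assume "bounded B"
  then obtain R where R: "R > 0" "\<And>f. f \<in> B \<Longrightarrow> norm f \<le> R"
    by (auto simp: bounded_pos)
  show "complete (closure (T ` B))"
    by (simp add: complete_eq_closed)
  fix e :: real assume e: "e > 0"
  \<comment> \<open>Differences in \<open>B\<close> have norm at most \<open>2 R\<close>, so each of the two terms below
    contributes at most \<open>e / 4\<close>. The increments by \<open>1\<close> in \<open>\<delta>\<close> cover \<open>K = 0\<close> and
    \<open>N = 0\<close>.\<close>
  have "e / (8 * R) > 0"
    using e R by simp
  then obtain N K where NK: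
      "\<And>f. norm (T f) \<le> e / (8 * R) * norm f + K * (\<Sum>j<N. cmod (c j f))"
    using small by blast
  define \<delta> where "\<delta> = e / (4 * (\<bar>K\<bar> + 1) * (real N + 1))"
  have \<delta>: "\<delta> > 0"
    using e by (simp add: \<delta>_def add_nonneg_pos)
  have cB: "bounded (c j ` B)" for j
  proof -
    have "cmod (c j f) \<le> \<bar>C j\<bar> * R" if "f \<in> B" for f
    proof -
      have "C j * norm f \<le> \<bar>C j\<bar> * R"
        using R(2)[OF that] by (intro mult_mono) auto
      then show ?thesis
        using bdd[of j f] by simp
    qed
    then show ?thesis
      by (auto simp: bounded_iff)
  qed
  obtain F where F: "finite F" "F \<subseteq> B"
      "\<And>f. f \<in> B \<Longrightarrow> \<exists>g\<in>F. \<forall>j<N. cmod (c j f - c j g) < \<delta>"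
    using finite_net_for_functionals[of c B \<delta> N] cB \<delta> by metis
  have "T ` B \<subseteq> (\<Union>x\<in>T ` F. cball x (e / 2))"
  proof clarify
    fix f assume f: "f \<in> B"
    then obtain g where g: "g \<in> F" "\<And>j. j < N \<Longrightarrow> cmod (c j f - c j g) < \<delta>"
      using F(3) by blast
    have "norm (T f - T g) = norm (T (f - g))"
      by (simp add: bounded_linear.linear[OF T] linear_diff)
    also have "\<dots> \<le> e / (8 * R) * norm (f - g) + K * (\<Sum>j<N. cmod (c j (f - g)))"
      by (rule NK)
    also have "\<dots> \<le> e / (8 * R) * (2 * R) + (\<bar>K\<bar> + 1) * ((real N + 1) * \<delta>)"
    proof (rule add_mono)
      have "norm (f - g) \<le> 2 * R"
        using norm_triangle_ineq4[of f g] R(2)[OF f] R(2)[of g] g(1) F(2) by fastforce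
      then show "e / (8 * R) * norm (f - g) \<le> e / (8 * R) * (2 * R)"
        using e R by (intro mult_left_mono) auto
      have "(\<Sum>j<N. cmod (c j (f - g))) \<le> (\<Sum>j<N. \<delta>)"
        by (intro sum_mono) (simp add: diff g(2) less_imp_le)
      also have "\<dots> \<le> (real N + 1) * \<delta>"
        using \<delta> by (simp add: algebra_simps)
      finally show "K * (\<Sum>j<N. cmod (c j (f - g))) \<le> (\<bar>K\<bar> + 1) * ((real N + 1) * \<delta>)"
        by (intro mult_mono) (auto intro: sum_nonneg)
    qed
    also have "\<dots> = e / 2"
    proof -
      have "\<bar>K\<bar> + 1 \<noteq> 0" "real N + 1 \<noteq> 0"
        by linarith+
      then show ?thesis
        using R(1) by (simp add: \<delta>_def divide_simps) (simp add: algebra_simps)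
    qed
    finally have "T f \<in> cball (T g) (e / 2)"
      by (simp add: dist_norm norm_minus_commute)
    then show "T f \<in> (\<Union>x\<in>T ` F. cball x (e / 2))"
      using g(1) by blast
  qed
  then have "closure (T ` B) \<subseteq> (\<Union>x\<in>T ` F. cball x (e / 2))"
    using F(1) by (intro closure_minimal closed_UN) auto
  also have "\<dots> \<subseteq> (\<Union>x\<in>T ` F. ball x e)"
    using e by force
  finally show "\<exists>k. finite k \<and> closure (T ` B) \<subseteq> (\<Union>x\<in>k. ball x e)"
    using F(1) by blast
qed

section \<open>Linear combinations of composition operators\<close>

context
  fixes k :: nat and lam :: "nat \<Rightarrow> complex" and \<phi> :: "nat \<Rightarrow> complex \<Rightarrow> complex"
begin

text \<open>The linear combination of composition operators.\<close>
definition comp_sum :: "hinf \<Rightarrow> hinf" where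
  "comp_sum f = (\<Sum>i=1..k. lam i *\<^sub>C composition_op (\<phi> i) f)"

text \<open>
  The same linear combination of the \<open>n\<close>-th pointwise powers, which is the image of the monomial
  of degree \<open>n\<close> under \<open>comp_sum\<close>.
\<close>
definition power_sum :: "nat \<Rightarrow> complex \<Rightarrow> complex" where
  "power_sum n z = (\<Sum>i=1..k. lam i * \<phi> i z ^ n)"

context
  assumes self_map: "\<And>i. i \<in> {1..k} \<Longrightarrow> analytic_self_map (\<phi> i)"
begin

lemma self_map_in_disk: "i \<in> {1..k} \<Longrightarrow> z \<in> unit_disk \<Longrightarrow> \<phi> i z \<in> unit_disk"
  using self_map unfolding analytic_self_map_def by blast

lemma hinf_fun_comp_sum:
  assumes "z \<in> unit_disk"
  shows "hinf_fun (comp_sum f) z = (\<Sum>i=1..k. lam i * hinf_fun f (\<phi> i z))"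
proof -
  have "hinf_fun (\<Sum>i\<in>A. F i) z = (\<Sum>i\<in>A. hinf_fun (F i) z)" if "finite A" for A :: "nat set" and F
    using that by induction (simp_all add: zero_hinf.rep_eq plus_hinf.rep_eq)
  then show ?thesis
    unfolding comp_sum_def
    by (auto simp: scaleC_hinf.rep_eq hinf_fun_composition_op[OF self_map assms] intro!: sum.cong)
qed

lemma norm_sum_self_maps_le:
  assumes "\<And>i. i \<in> {1..k} \<Longrightarrow> cmod (u i) \<le> M"
  shows "cmod (\<Sum>i=1..k. lam i * u i) \<le> (\<Sum>i=1..k. cmod (lam i)) * M"
  unfolding sum_distrib_right
proof (rule sum_norm_le)
  show "cmod (lam i * u i) \<le> cmod (lam i) * M" if "i \<in> {1..k}" for i
    unfolding norm_mult using assms[OF that] by (rule mult_left_mono) simp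
qed

lemma bounded_linear_comp_sum: "bounded_linear comp_sum"
proof (rule bounded_linear_intro[of _ "\<Sum>i=1..k. cmod (lam i)"])
  show "comp_sum (f + g) = comp_sum f + comp_sum g" for f g
    by (rule hinf_eqI)
      (simp add: hinf_fun_comp_sum plus_hinf.rep_eq distrib_left sum.distrib)
  show "comp_sum (r *\<^sub>R f) = r *\<^sub>R comp_sum f" for r f
    by (rule hinf_eqI)
      (simp add: hinf_fun_comp_sum scaleR_hinf.rep_eq sum_distrib_left mult.left_commute)
  show "norm (comp_sum f) \<le> norm f * (\<Sum>i=1..k. cmod (lam i))" for f
  proof (rule hinf_norm_le)
    fix z :: complex assume z: "z \<in> unit_disk"
    show "cmod (hinf_fun (comp_sum f) z) \<le> norm f * (\<Sum>i=1..k. cmod (lam i))"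
      unfolding hinf_fun_comp_sum[OF z] mult.commute[of "norm f"]
      by (intro norm_sum_self_maps_le hinf_fun_le_norm self_map_in_disk z)
  qed
qed

lemma norm_power_sum_le:
  assumes "z \<in> unit_disk"
  shows "cmod (power_sum n z) \<le> (\<Sum>i=1..k. cmod (lam i))"
proof -
  have "cmod (\<phi> i z ^ n) \<le> 1" if "i \<in> {1..k}" for i
    using self_map_in_disk[OF that assms] by (simp add: norm_power power_le_one)
  then have "cmod (power_sum n z) \<le> (\<Sum>i=1..k. cmod (lam i)) * 1"
    unfolding power_sum_def by (rule norm_sum_self_maps_le)
  then show ?thesis
    by simp
qed

lemma norm_power_sum_le_sup_norm:
  assumes "z \<in> unit_disk"
  shows "cmod (power_sum n z) \<le> disk_sup_norm (power_sum n)"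
proof (rule disk_sup_norm_upper[OF _ assms])
  show "bounded (power_sum n ` unit_disk)"
    unfolding bounded_iff using norm_power_sum_le by blast
qed

text \<open>
  The sum on the left is the value at \<open>z\<close> of the operator applied to \<open>w\<^sup>N g(w)\<close>. It equals
  \<open>\<Sum>d\<^sub>n p(z)\<close> with \<open>p = power_sum (N + n)\<close>, where \<open>d\<^sub>n\<close> are the coefficients of
  \<open>g\<close>, and so only powers of degree at least \<open>N\<close> enter.
\<close>
lemma norm_sum_power_times_le:
  assumes g: "wiener_bounded g M" and z: "z \<in> unit_disk"
    and small: "\<And>n. n \<ge> N \<Longrightarrow> cmod (power_sum n z) \<le> e"
  shows "cmod (\<Sum>i=1..k. lam i * (\<phi> i z ^ N * g (\<phi> i z))) \<le> e * M"
proof -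
  have e: "e \<ge> 0"
    using small[of N] norm_ge_zero[of "power_sum N z"] by linarith
  obtain d where d: "summable (\<lambda>n. cmod (d n))" "(\<Sum>n. cmod (d n)) \<le> M"
      "\<And>w. w \<in> unit_disk \<Longrightarrow> (\<lambda>n. d n * w ^ n) sums g w"
    using g unfolding wiener_bounded_def by blast
  have "(\<lambda>n. \<Sum>i=1..k. lam i * (\<phi> i z ^ N * (d n * \<phi> i z ^ n)))
      sums (\<Sum>i=1..k. lam i * (\<phi> i z ^ N * g (\<phi> i z)))"
    by (intro sums_sum sums_mult d(3) self_map_in_disk z)
  also have "(\<lambda>n. \<Sum>i=1..k. lam i * (\<phi> i z ^ N * (d n * \<phi> i z ^ n)))
      = (\<lambda>n. d n * power_sum (N + n) z)"
    by (simp add: power_sum_def sum_distrib_left power_add algebra_simps)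
  finally have sums: "(\<lambda>n. d n * power_sum (N + n) z)
      sums (\<Sum>i=1..k. lam i * (\<phi> i z ^ N * g (\<phi> i z)))" .
  have le: "cmod (d n * power_sum (N + n) z) \<le> e * cmod (d n)" for n
    using mult_left_mono[OF small[of "N + n"] norm_ge_zero[of "d n"]]
    by (simp add: norm_mult mult.commute)
  have s: "summable (\<lambda>n. e * cmod (d n))"
    using d(1) by (rule summable_mult)
  have "cmod (\<Sum>n. d n * power_sum (N + n) z) \<le> (\<Sum>n. e * cmod (d n))"
    by (rule norm_suminf_le[OF le s])
  also have "\<dots> = e * (\<Sum>n. cmod (d n))"
    by (rule suminf_mult[OF d(1)])
  also have "\<dots> \<le> e * M"
    using d(2) e by (rule mult_left_mono)
  finally show ?thesis
    using sums by (simp add: sums_iff)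
qed

text \<open>
  The factor in front of the norm of \<open>f\<close> depends on \<open>N\<close> only through \<open>e\<close>.
\<close>
lemma norm_comp_sum_le:
  assumes small: "\<And>n. n \<ge> N \<Longrightarrow> disk_sup_norm (power_sum n) \<le> e"
  shows "norm (comp_sum f) \<le> 7 ^ k * e * norm f
    + (7 ^ k * e + (\<Sum>i=1..k. cmod (lam i))) * (\<Sum>j<N. cmod (taylor_coeff j f))"
proof (rule hinf_norm_le)
  fix z :: complex assume z: "z \<in> unit_disk"
  let ?\<Lambda> = "\<Sum>i=1..k. cmod (lam i)" and ?S = "\<Sum>j<N. cmod (taylor_coeff j f)"
  obtain q where q: "q holomorphic_on unit_disk"
    "\<And>z. z \<in> unit_disk \<Longrightarrow>
       hinf_fun f z = (\<Sum>j<N. taylor_coeff j f * z ^ j) + z ^ N * q z"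
    "\<And>z. z \<in> unit_disk \<Longrightarrow> cmod (q z) \<le> norm f + ?S"
    using taylor_remainder by blast
  \<comment> \<open>For this \<open>z\<close>, \<open>q\<close> matters only at the nodes \<open>\<phi> i z\<close>, where it may be replaced by
    \<open>g\<close>; the interpolant varies with \<open>z\<close>, but its bound does not.\<close>
  let ?as = "map (\<lambda>i. \<phi> i z) [1..<Suc k]"
  have as: "set ?as = (\<lambda>i. \<phi> i z) ` {1..k}" "length ?as = k"
    by (simp_all add: atLeastLessThanSuc_atLeastAtMost del: upt_Suc)
  have "set ?as \<subseteq> unit_disk"
    unfolding as using self_map_in_disk z by blast
  then obtain g where g: "wiener_bounded g (7 ^ k * (norm f + ?S))"
      "\<And>i. i \<in> {1..k} \<Longrightarrow> g (\<phi> i z) = q (\<phi> i z)"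
    using wiener_interpolation[OF q(1,3), of ?as] unfolding as by blast
  have "hinf_fun (comp_sum f) z
      = (\<Sum>i=1..k. lam i * ((\<Sum>j<N. taylor_coeff j f * \<phi> i z ^ j) + \<phi> i z ^ N * g (\<phi> i z)))"
    unfolding hinf_fun_comp_sum[OF z]
    by (intro sum.cong refl) (simp add: q(2)[OF self_map_in_disk[OF _ z]] g(2))
  also have "\<dots> = (\<Sum>i=1..k. \<Sum>j<N. lam i * (taylor_coeff j f * \<phi> i z ^ j))
      + (\<Sum>i=1..k. lam i * (\<phi> i z ^ N * g (\<phi> i z)))"
    by (simp add: distrib_left sum.distrib sum_distrib_left)
  also have "(\<Sum>i=1..k. \<Sum>j<N. lam i * (taylor_coeff j f * \<phi> i z ^ j))
      = (\<Sum>j<N. taylor_coeff j f * power_sum j z)"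
    unfolding power_sum_def sum_distrib_left
    by (subst sum.swap) (simp add: mult.left_commute)
  finally have eq: "hinf_fun (comp_sum f) z = (\<Sum>j<N. taylor_coeff j f * power_sum j z)
      + (\<Sum>i=1..k. lam i * (\<phi> i z ^ N * g (\<phi> i z)))" .
  have "cmod (\<Sum>j<N. taylor_coeff j f * power_sum j z) \<le> ?S * ?\<Lambda>"
    unfolding sum_distrib_right
    by (rule sum_norm_le)
      (unfold norm_mult, rule mult_left_mono[OF norm_power_sum_le[OF z] norm_ge_zero])
  moreover have "cmod (power_sum n z) \<le> e" if "n \<ge> N" for n
    using norm_power_sum_le_sup_norm[OF z] small[OF that] by (rule order_trans)
  then have "cmod (\<Sum>i=1..k. lam i * (\<phi> i z ^ N * g (\<phi> i z))) \<le> e * (7 ^ k * (norm f + ?S))"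
    using norm_sum_power_times_le[OF g(1) z] by blast
  ultimately have "cmod (hinf_fun (comp_sum f) z) \<le> ?S * ?\<Lambda> + e * (7 ^ k * (norm f + ?S))"
    unfolding eq by (rule norm_triangle_mono)
  then show "cmod (hinf_fun (comp_sum f) z) \<le> 7 ^ k * e * norm f + (7 ^ k * e + ?\<Lambda>) * ?S"
    by (simp add: algebra_simps)
qed

lemma compact_comp_sum_if:
  assumes "(\<lambda>n. disk_sup_norm (power_sum n)) \<longlonglongrightarrow> 0"
  shows "compact_operator comp_sum"
proof (rule compact_operator_if_small_modulo_functionals[where c = taylor_coeff])
  show "bounded_linear comp_sum"
    by (rule bounded_linear_comp_sum)
  show "cmod (taylor_coeff j f) \<le> 2 ^ j * norm f" for j f
    by (rule norm_taylor_coeff_le)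
  fix e :: real assume "e > 0"
  then have "e / 7 ^ k > 0"
    by simp
  then have "\<forall>\<^sub>F n in sequentially. disk_sup_norm (power_sum n) < e / 7 ^ k"
    using order_tendstoD(2)[OF assms] by blast
  then obtain N where "\<And>n. n \<ge> N \<Longrightarrow> disk_sup_norm (power_sum n) \<le> e / 7 ^ k"
    unfolding eventually_sequentially by (meson less_imp_le)
  from norm_comp_sum_le[OF this]
  show "\<exists>N K. \<forall>f. norm (comp_sum f) \<le> e * norm f + K * (\<Sum>j<N. cmod (taylor_coeff j f))"
    by (intro exI[of _ N] exI[of _ "e + (\<Sum>i=1..k. cmod (lam i))"]) simp
qed (rule taylor_coeff_diff)

lemma power_sum_tendsto_0_if:
  assumes "compact_operator comp_sum"
  shows "(\<lambda>n. disk_sup_norm (power_sum n)) \<longlonglongrightarrow> 0"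
proof -
  let ?e = "\<lambda>n. to_hinf (\<lambda>z. z ^ n)"
  have e: "hinf_fun (?e n) z = z ^ n" if "z \<in> unit_disk" for n z
  proof (rule hinf_fun_to_hinf[OF _ _ that])
    show "bounded ((\<lambda>z::complex. z ^ n) ` unit_disk)"
      unfolding bounded_iff by (intro exI[of _ 1]) (auto simp: norm_power intro: power_le_one)
  qed (intro holomorphic_intros)
  have Te: "hinf_fun (comp_sum (?e n)) z = power_sum n z" if "z \<in> unit_disk" for n z
    by (simp add: hinf_fun_comp_sum[OF that] power_sum_def e[OF self_map_in_disk[OF _ that]])
  have "norm (?e n) \<le> 1" for n
    by (rule hinf_norm_le) (use e in \<open>auto simp: norm_power intro: power_le_one\<close>)
  then have "bounded (range ?e)"
    unfolding bounded_iff by blast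
  then have cpt: "compact (closure (comp_sum ` range ?e))"
    using assms unfolding compact_operator_def by blast
  have norm_eq: "disk_sup_norm (power_sum n) = norm (comp_sum (?e n))" for n
    unfolding norm_hinf.rep_eq by (rule disk_sup_norm_cong) (simp add: Te)
  have pointwise: "(\<lambda>n. power_sum n z) \<longlonglongrightarrow> 0" if "z \<in> unit_disk" for z
    unfolding power_sum_def
    using self_map_in_disk[OF _ that]
    by (intro tendsto_null_sum tendsto_mult_right_zero LIMSEQ_power_zero) simp
  \<comment> \<open>Otherwise a subsequence stays away from \<open>0\<close> in norm; compactness gives it a norm limit
    \<open>l\<close> of a further subsequence, and \<open>l\<close> must be the pointwise limit \<open>0\<close>.\<close>
  have "(\<lambda>n. comp_sum (?e n)) \<longlonglongrightarrow> 0"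
  proof (rule ccontr)
    assume "\<not> (\<lambda>n. comp_sum (?e n)) \<longlonglongrightarrow> 0"
    then obtain \<epsilon> where \<epsilon>: "\<epsilon> > 0" "\<exists>\<^sub>F n in sequentially. \<not> norm (comp_sum (?e n)) < \<epsilon>"
      unfolding tendsto_iff by (auto simp: not_eventually)
    then have "infinite {n. \<not> norm (comp_sum (?e n)) < \<epsilon>}"
      by (simp add: cofinite_eq_sequentially[symmetric] frequently_cofinite)
    then obtain r :: "nat \<Rightarrow> nat" where r: "strict_mono r" "\<And>n. norm (comp_sum (?e (r n))) \<ge> \<epsilon>"
      using infinite_enumerate[of "{n. \<not> norm (comp_sum (?e n)) < \<epsilon>}"]
      by (auto simp: not_less)
    have "comp_sum (?e (r n)) \<in> closure (comp_sum ` range ?e)" for n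
      by (intro subsetD[OF closure_subset] imageI rangeI)
    then have "\<forall>n. comp_sum (?e (r n)) \<in> closure (comp_sum ` range ?e)"
      by (rule allI)
    then obtain l s where "strict_mono s" "((\<lambda>n. comp_sum (?e (r n))) \<circ> s) \<longlonglongrightarrow> l"
      by (rule seq_compactE[OF compact_imp_seq_compact[OF cpt]])
    then have s: "strict_mono s" "(\<lambda>n. comp_sum (?e (r (s n)))) \<longlonglongrightarrow> l"
      by (simp_all add: comp_def)
    have "hinf_fun l z = 0" if z: "z \<in> unit_disk" for z
    proof -
      have "cmod (power_sum (r (s n)) z - hinf_fun l z) \<le> norm (comp_sum (?e (r (s n))) - l)"
        for n
        using hinf_fun_le_norm[OF z, of "comp_sum (?e (r (s n))) - l"]
        by (simp add: minus_hinf.rep_eq Te[OF z])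
      then have "(\<lambda>n. power_sum (r (s n)) z - hinf_fun l z) \<longlonglongrightarrow> 0"
        by (rule Lim_null_comparison[OF always_eventually[OF allI]])
          (rule tendsto_norm_zero[OF LIM_zero[OF s(2)]])
      then have "(\<lambda>n. power_sum (r (s n)) z) \<longlonglongrightarrow> hinf_fun l z"
        by (rule LIM_zero_cancel)
      moreover have "(\<lambda>n. power_sum (r (s n)) z) \<longlonglongrightarrow> 0"
        using LIMSEQ_subseq_LIMSEQ[OF LIMSEQ_subseq_LIMSEQ[OF pointwise[OF z] r(1)] s(1)]
        by (simp add: comp_def)
      ultimately show ?thesis
        by (rule LIMSEQ_unique)
    qed
    then have "l = 0"
      by (intro hinf_eqI) (simp add: zero_hinf.rep_eq)
    have "(\<lambda>n. norm (comp_sum (?e (r (s n))))) \<longlonglongrightarrow> 0"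
      using tendsto_norm_zero[OF s(2)[unfolded \<open>l = 0\<close>]] by simp
    then have "\<epsilon> \<le> 0"
      by (rule LIMSEQ_le_const) (intro exI allI impI r(2))
    with \<epsilon>(1) show False
      by simp
  qed
  then show ?thesis
    unfolding norm_eq by (rule tendsto_norm_zero)
qed

end

end

theorem theorem2:
  fixes k :: nat
    and lam :: "nat \<Rightarrow> complex"
    and \<phi> :: "nat \<Rightarrow> complex \<Rightarrow> complex"
  assumes "k \<ge> 1"
    and "\<And>i. i \<in> {1..k} \<Longrightarrow> lam i \<noteq> 0"
    and "\<And>i. i \<in> {1..k} \<Longrightarrow> analytic_self_map (\<phi> i)"
  shows "compact_operator (\<lambda>f. \<Sum>i=1..k. lam i *\<^sub>C composition_op (\<phi> i) f) \<longleftrightarrow>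
    (\<lambda>n. disk_sup_norm (\<lambda>z. \<Sum>i=1..k. lam i * \<phi> i z ^ n)) \<longlonglongrightarrow> 0"
proof -
  have "compact_operator (comp_sum k lam \<phi>) \<longleftrightarrow>
      (\<lambda>n. disk_sup_norm (power_sum k lam \<phi> n)) \<longlonglongrightarrow> 0"
    using compact_comp_sum_if[of k \<phi> lam] power_sum_tendsto_0_if[of k \<phi> lam] assms(3)
    by (intro iffI) simp_all
  then show ?thesis
    unfolding comp_sum_def[abs_def] power_sum_def[abs_def] .
qed

end
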